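(* Let $\mathbb{L}_{\mathrm{strong}}$ be the set of strong Liouville numbers and let $\mathcal{L}$ be the set of Liouville numbers defined in the context. Then $\mathbb{L}_{\mathrm{strong}}\subseteq\mathcal{L}$, and $\mathcal{L}\setminus\mathbb{L}_{\mathrm{strong}}$ is an uncountable set.
   Context: A real irrational number $\xi$, with $(p_k/q_k)_k$ the sequence of convergents of its continued fraction, is a strong Liouville number if for every positive integer $n$ there exists $N$ (depending on $n$) such that $q_{k+1}>q_k^n$ for all $k>N$. For a rational number $p/q$ in lowest terms, $H(p/q)=\max\{|p|,|q|\}$. The set $\mathcal{L}$ consists of the real numbers $\xi$ for which there exist a sequence $(\omega_n)_{n\ge1}$ of positive real numbers with $\omega_n\to\infty$, a sequence of rational numbers $(p_n/q_n)_{n\ge 1}$ taking infinitely many distinct values, and a constant $C>0$ such that, for all $n\ge 1$, $|\xi-p_n/q_n|<H(p_n/q_n)^{-\omega_n}$ and $H(p_{n+1}/q_{n+1})\le H(p_n/q_n)^{C\omega_n}$. *)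

theory Defs
  imports Complex_Main "HOL-Library.Countable_Set"
begin

fun finite_cfrac :: "int list \<Rightarrow> rat" where
  "finite_cfrac [] = 0"
| "finite_cfrac [a] = of_int a"
| "finite_cfrac (a # b # as) = of_int a + 1 / finite_cfrac (b # as)"

text \<open>For irrational \<open>x\<close> no complete quotient is an integer, so the division below is never
  a division by zero.\<close>

primrec cf_complete_quotient :: "real \<Rightarrow> nat \<Rightarrow> real" where
  "cf_complete_quotient x 0 = x"
| "cf_complete_quotient x (Suc k) = 1 / frac (cf_complete_quotient x k)"

definition cf_partial_quotient :: "real \<Rightarrow> nat \<Rightarrow> int" where
  "cf_partial_quotient x k = \<lfloor>cf_complete_quotient x k\<rfloor>"

definition cf_convergent :: "real \<Rightarrow> nat \<Rightarrow> rat" where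
  "cf_convergent x k = finite_cfrac (map (cf_partial_quotient x) [0..<Suc k])"

text \<open>\<open>quotient_of\<close> returns numerator and denominator in lowest terms, with positive denominator.\<close>

definition cf_denom :: "real \<Rightarrow> nat \<Rightarrow> int" where
  "cf_denom x k = snd (quotient_of (cf_convergent x k))"

definition strong_Liouville :: "real set" where
  "strong_Liouville =
     {x. x \<notin> \<rat> \<and> (\<forall>n::nat. n \<ge> 1 \<longrightarrow> (\<exists>N. \<forall>k>N. cf_denom x (Suc k) > cf_denom x k ^ n))}"

definition rat_height :: "rat \<Rightarrow> int" where
  "rat_height r = (case quotient_of r of (p, q) \<Rightarrow> max \<bar>p\<bar> \<bar>q\<bar>)"

text \<open>Sequences are indexed by the positive integers; the values at index 0 are irrelevant.\<close>

definition Liouville_class :: "real set" where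
  "Liouville_class =
     {x. \<exists>(\<omega> :: nat \<Rightarrow> real) (r :: nat \<Rightarrow> rat) (C :: real).
        (\<forall>n\<ge>1. \<omega> n > 0) \<and> filterlim \<omega> at_top sequentially \<and>
        infinite (r ` {1..}) \<and> C > 0 \<and>
        (\<forall>n\<ge>1. \<bar>x - of_rat (r n)\<bar> < real_of_int (rat_height (r n)) powr (- \<omega> n) \<and>
           real_of_int (rat_height (r (Suc n))) \<le> real_of_int (rat_height (r n)) powr (C * \<omega> n))}"

end

(*
  If p_k/q_k are the convergents of x, then |x - p_k/q_k| < 1/(q_k q_{k+1}), so for a strong
  Liouville number the convergents themselves, with exponents ln q_{k+1} / ln H(p_k/q_k), witness
  membership in the class.

  Conversely, let x be a sum of terms e_n/Q_n with Q_n = 2^((n+2)!) and e_n in {1,3}. Its partial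
  sums s_n have height Q_n and approximate x to within 4/Q_{n+1}, where Q_{n+1} = Q_n^(n+3), which
  puts x into the class. They approximate so well that for a strong Liouville x both s_n and s_{n+1}
  would have to be convergents, say with q_k = Q_n. The size of x - s_n forces q_{k+1} to be
  Q_{n+1}/Q_n up to a constant factor; hence s_{n+1} comes after the (k+1)-st convergent, and
  q_{k+2} <= Q_{n+1} contradicts q_{k+2} > q_{k+1}^2.
*)

theory Submission
  imports Defs
begin

section \<open>Convergents in lowest terms, and the effect of prepending a partial quotient\<close>

abbreviation cf_num :: "real \<Rightarrow> nat \<Rightarrow> int" where
  "cf_num x k \<equiv> fst (quotient_of (cf_convergent x k))"

text \<open>The new fraction is already reduced, since gcd(a p + q, p) = gcd(q, p); positivity of
  \<open>p\<close> makes it admissible as a denominator.\<close>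

lemma quotient_of_add_inverse:
  assumes "quotient_of r = (p, q)" "p > 0"
  shows "quotient_of (of_int a + 1 / r) = (a * p + q, p)"
proof -
  have "q > 0" and "coprime p q" and r: "r = of_int p / of_int q"
    using assms quotient_of_denom_pos quotient_of_coprime quotient_of_div by blast+
  then have "coprime (a * p + q) p"
    by (metis add.commute coprime_commute gcd_add_mult coprime_iff_gcd_eq_1 mult.commute)
  moreover have "of_int a + 1 / r = Fract (a * p + q) p"
    using \<open>q > 0\<close> assms(2) by (simp add: r Fract_of_int_quotient field_simps)
  ultimately show ?thesis
    using assms(2) by (simp add: quotient_of_Fract normalize_stable)
qed

text \<open>The definition iterates at the far end; this moves the recursion to the front, so that
  \<open>1 / frac x\<close> carries the tail of the expansion.\<close>

lemma cf_complete_quotient_Suc_shift: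
  "cf_complete_quotient x (Suc k) = cf_complete_quotient (1 / frac x) k"
  by (induction k) auto

lemma cf_convergent_0: "cf_convergent x 0 = of_int \<lfloor>x\<rfloor>"
  by (simp add: cf_convergent_def cf_partial_quotient_def)

lemma cf_convergent_Suc:
  "cf_convergent x (Suc k) = of_int \<lfloor>x\<rfloor> + 1 / cf_convergent (1 / frac x) k"
proof -
  let ?m = "map (cf_partial_quotient (1 / frac x)) [0..<Suc k]"
  have "map (cf_partial_quotient x) [0..<Suc (Suc k)]
      = cf_partial_quotient x 0 # map (cf_partial_quotient x \<circ> Suc) [0..<Suc k]"
    by (metis map_map map_Suc_upt upt_conv_Cons list.simps(9) zero_less_Suc)
  also have "cf_partial_quotient x \<circ> Suc = cf_partial_quotient (1 / frac x)"
    by (rule ext) (simp only: o_def cf_partial_quotient_def cf_complete_quotient_Suc_shift)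
  also have "cf_partial_quotient x 0 = \<lfloor>x\<rfloor>"
    by (simp add: cf_partial_quotient_def)
  finally have *: "map (cf_partial_quotient x) [0..<Suc (Suc k)] = \<lfloor>x\<rfloor> # ?m" .
  \<comment> \<open>The recursive equation of \<open>finite_cfrac\<close> fires only on a list whose
    tail is nonempty.\<close>
  obtain b bs where "?m = b # bs"
    by (metis list.exhaust map_is_Nil_conv upt_eq_Nil_conv nat.distinct(1) not_less_eq_eq le0)
  then have "finite_cfrac (\<lfloor>x\<rfloor> # ?m) = of_int \<lfloor>x\<rfloor> + 1 / finite_cfrac ?m"
    by simp
  then show ?thesis
    unfolding cf_convergent_def * .
qed

lemma inverse_frac_irrational:
  assumes "x \<notin> \<rat>"
  shows "1 / frac x \<notin> \<rat>" "1 / frac x > 1" "x = of_int \<lfloor>x\<rfloor> + 1 / (1 / frac x)"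
proof -
  have "x \<notin> \<int>" using assms Ints_subset_Rats by blast
  then have f: "0 < frac x" "frac x < 1"
    by (auto simp: frac_lt_1 frac_gt_0_iff)
  show "1 / frac x > 1" using f by simp
  show x: "x = of_int \<lfloor>x\<rfloor> + 1 / (1 / frac x)" by (simp add: frac_def)
  show "1 / frac x \<notin> \<rat>"
  proof
    assume "1 / frac x \<in> \<rat>"
    then have "of_int \<lfloor>x\<rfloor> + 1 / (1 / frac x) \<in> \<rat>"
      by (metis Rats_1 Rats_add Rats_divide Rats_of_int)
    with x assms show False by metis
  qed
qed

lemma cf_convergent_ge_1:
  assumes "x \<notin> \<rat>" "x > 1"
  shows "cf_convergent x k \<ge> 1"
  using assms
proof (induction k arbitrary: x)
  case 0
  then show ?case by (simp add: cf_convergent_0)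
next
  case (Suc k)
  have "cf_convergent (1 / frac x) k \<ge> 1"
    using Suc.IH inverse_frac_irrational[OF Suc.prems(1)] by blast
  moreover have "(1 :: rat) \<le> of_int \<lfloor>x\<rfloor>" using Suc.prems(2) by simp
  ultimately show ?case unfolding cf_convergent_Suc
    by (smt (verit) divide_nonneg_nonneg zero_le_one order_trans add_increasing2)
qed

lemma cf_num_pos:
  assumes "x \<notin> \<rat>" "x > 1"
  shows "cf_num x k > 0"
proof -
  have "cf_convergent x k > 0"
    using cf_convergent_ge_1[OF assms, of k] by linarith
  then show ?thesis
    by (metis quotient_of_div quotient_of_denom_pos' prod.collapse of_int_0_less_iff
        zero_less_divide_iff order_less_asym)
qed

text \<open>In matrix form, the column of numerator and denominator is multiplied on the left by the
  matrix with rows (floor of \<open>x\<close>, 1) and (1, 0), of determinant -1.\<close>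

lemma cf_num_denom_Suc:
  assumes "x \<notin> \<rat>"
  shows "cf_num x (Suc k) = \<lfloor>x\<rfloor> * cf_num (1 / frac x) k + cf_denom (1 / frac x) k"
    and "cf_denom x (Suc k) = cf_num (1 / frac x) k"
proof -
  have "quotient_of (cf_convergent x (Suc k))
      = (\<lfloor>x\<rfloor> * cf_num (1 / frac x) k + cf_denom (1 / frac x) k, cf_num (1 / frac x) k)"
    unfolding cf_convergent_Suc
    using inverse_frac_irrational[OF assms] cf_num_pos
    by (intro quotient_of_add_inverse) (auto simp: cf_denom_def)
  then show "cf_num x (Suc k) = \<lfloor>x\<rfloor> * cf_num (1 / frac x) k + cf_denom (1 / frac x) k"
    and "cf_denom x (Suc k) = cf_num (1 / frac x) k"
    by (simp_all add: cf_denom_def)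
qed

lemma cf_num_0: "cf_num x 0 = \<lfloor>x\<rfloor>" and cf_denom_0: "cf_denom x 0 = 1"
  by (simp_all add: cf_denom_def cf_convergent_0)

section \<open>Approximation by convergents, and heights\<close>

text \<open>Prepending \<open>\<lfloor>x\<rfloor>\<close> to the expansion of \<open>1 / frac x\<close> turns each statement about convergents
  into an induction on \<open>k\<close> with \<open>x\<close> arbitrary.\<close>

lemma cf_determinant:
  assumes "x \<notin> \<rat>"
  shows "\<bar>cf_num x k * cf_denom x (Suc k) - cf_num x (Suc k) * cf_denom x k\<bar> = 1"
  using assms
proof (induction k arbitrary: x)
  case 0
  then show ?case
    by (simp add: cf_num_denom_Suc cf_num_0 cf_denom_0 algebra_simps)
next
  case (Suc k)
  then show ?case
    using Suc.IH[OF inverse_frac_irrational(1)[OF Suc.prems]]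
    by (simp add: cf_num_denom_Suc[OF Suc.prems] algebra_simps abs_minus_commute)
qed

text \<open>The map sending y to floor(x) + 1/y reverses order on the positive reals, so each
  induction step swaps the two intervals. The union covers both orientations without tracking the
  parity of \<open>k\<close>.\<close>

lemma between_consecutive_convergents:
  assumes "x \<notin> \<rat>"
  shows "x \<in> {of_rat (cf_convergent x k)<..<of_rat (cf_convergent x (Suc k))}
           \<union> {of_rat (cf_convergent x (Suc k))<..<of_rat (cf_convergent x k)}"
  using assms
proof (induction k arbitrary: x)
  case 0
  let ?y = "1 / frac x"
  note y = inverse_frac_irrational[OF 0]
  have fl: "of_int \<lfloor>?y\<rfloor> < ?y"
    using y(1) by (metis Rats_of_int of_int_floor_le order_le_less)
  have fl1: "(1::real) \<le> of_int \<lfloor>?y\<rfloor>" using y(2) by simp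
  have "1 / ?y < 1 / of_int \<lfloor>?y\<rfloor>"
    using fl fl1 by (intro divide_strict_left_mono mult_pos_pos) linarith+
  moreover have "0 < 1 / ?y" using y(2) by (intro divide_pos_pos[of 1 ?y]) linarith+
  ultimately have "of_int \<lfloor>x\<rfloor> < x" "x < of_int \<lfloor>x\<rfloor> + 1 / of_int \<lfloor>?y\<rfloor>"
    using y(3) by linarith+
  then show ?case
    by (simp add: cf_convergent_Suc cf_convergent_0 of_rat_add of_rat_divide)
next
  case (Suc k)
  let ?y = "1 / frac x"
  note y = inverse_frac_irrational[OF Suc.prems]
  have pos: "0 < (of_rat (cf_convergent ?y i) :: real)" for i
    using cf_convergent_ge_1[OF y(1,2), of i] by simp
  have inv: "1 / u < 1 / v" if "0 < v" "v < u" for u v :: real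
    using that by (intro divide_strict_left_mono) auto
  have "1 / ?y \<in> {1 / of_rat (cf_convergent ?y k)<..<1 / of_rat (cf_convergent ?y (Suc k))}
      \<union> {1 / of_rat (cf_convergent ?y (Suc k))<..<1 / of_rat (cf_convergent ?y k)}"
    using Suc.IH[OF y(1)] pos[of k] pos[of "Suc k"] y(2)
      inv[of ?y "of_rat (cf_convergent ?y k)"] inv[of ?y "of_rat (cf_convergent ?y (Suc k))"]
      inv[of "of_rat (cf_convergent ?y k)" ?y] inv[of "of_rat (cf_convergent ?y (Suc k))" ?y]
    unfolding Un_iff greaterThanLessThan_iff by linarith
  then show ?case
    unfolding cf_convergent_Suc[of x] of_rat_add of_rat_divide of_rat_of_int_eq of_rat_1
      Un_iff greaterThanLessThan_iff
    using y(3) by linarith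
qed

lemma cf_denom_pos: "cf_denom x k > 0"
  unfolding cf_denom_def by (rule quotient_of_denom_pos')

lemma of_rat_eq_quotient:
  "(of_rat r :: real) = of_int (fst (quotient_of r)) / of_int (snd (quotient_of r))"
  using quotient_of_div[of r] by (metis of_rat_divide of_rat_of_int_eq prod.collapse)

text \<open>By the determinant identity consecutive convergents are exactly 1/(q_k q_{k+1}) apart,
  and \<open>x\<close> lies strictly between them.\<close>

lemma cf_approximation:
  assumes "x \<notin> \<rat>"
  shows "\<bar>x - of_rat (cf_convergent x k)\<bar> < 1 / (of_int (cf_denom x k) * of_int (cf_denom x (Suc k)))"
proof -
  let ?p = "\<lambda>i. real_of_int (cf_num x i)" and ?q = "\<lambda>i. real_of_int (cf_denom x i)"
  let ?r = "\<lambda>i. of_rat (cf_convergent x i) :: real"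
  have r: "?r i = ?p i / ?q i" for i
    unfolding cf_denom_def by (rule of_rat_eq_quotient)
  have q: "?q i > 0" for i using cf_denom_pos by simp
  have "\<bar>?p k * ?q (Suc k) - ?p (Suc k) * ?q k\<bar> = 1"
    using cf_determinant[OF assms, of k]
    by (metis of_int_1 of_int_abs of_int_diff of_int_mult)
  moreover have "?r k - ?r (Suc k) = (?p k * ?q (Suc k) - ?p (Suc k) * ?q k) / (?q k * ?q (Suc k))"
    unfolding r using q[of k] q[of "Suc k"] by (simp add: field_simps)
  ultimately have "\<bar>?r k - ?r (Suc k)\<bar> = 1 / (?q k * ?q (Suc k))"
    using q[of k] q[of "Suc k"] by (simp add: abs_mult)
  then show ?thesis
    using between_consecutive_convergents[OF assms, of k] by auto
qed

text \<open>Over the product of the denominators, the difference has a nonzero integer as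
  numerator.\<close>

lemma rat_separation:
  assumes "r \<noteq> s"
  shows "\<bar>of_rat r - of_rat s :: real\<bar>
    \<ge> 1 / (of_int (snd (quotient_of r)) * of_int (snd (quotient_of s)))"
proof -
  obtain p q where pq: "quotient_of r = (p, q)" by fastforce
  obtain p' q' where pq': "quotient_of s = (p', q')" by fastforce
  have q: "q > 0" "q' > 0" using pq pq' quotient_of_denom_pos by blast+
  have e: "(of_rat r :: real) = of_int p / of_int q" "(of_rat s :: real) = of_int p' / of_int q'"
    using pq pq' by (simp_all add: of_rat_eq_quotient)
  have d: "(of_rat r - of_rat s :: real) = of_int (p * q' - p' * q) / (of_int q * of_int q')"
    unfolding e using q by (simp add: field_simps)
  have "(of_rat r - of_rat s :: real) \<noteq> 0" using assms by simp
  then have "p * q' - p' * q \<noteq> 0" unfolding d by fastforce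
  then have "1 \<le> \<bar>p * q' - p' * q\<bar>" by linarith
  then have "(1::real) \<le> \<bar>of_int (p * q' - p' * q)\<bar>"
    by (metis of_int_1_le_iff of_int_abs)
  then show ?thesis unfolding d using q pq pq'
    by (simp add: abs_mult divide_right_mono)
qed

lemma cf_denom_le_rat_height: "cf_denom x k \<le> rat_height (cf_convergent x k)"
  by (auto simp: cf_denom_def rat_height_def split: prod.splits)

lemma rat_height_cf_convergent_le:
  assumes "x \<notin> \<rat>"
  shows "of_int (rat_height (cf_convergent x k)) \<le> (\<bar>x\<bar> + 1) * of_int (cf_denom x k)"
proof -
  let ?p = "real_of_int (cf_num x k)" and ?q = "real_of_int (cf_denom x k)"
  have q: "?q \<ge> 1" "real_of_int (cf_denom x (Suc k)) \<ge> 1"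
    using cf_denom_pos[of x k] cf_denom_pos[of x "Suc k"] by linarith+
  have "\<bar>x - ?p / ?q\<bar> < 1 / (?q * of_int (cf_denom x (Suc k)))"
    using cf_approximation[OF assms, of k] by (simp add: of_rat_eq_quotient cf_denom_def)
  also have "\<dots> \<le> 1 / ?q"
    using q by (intro divide_left_mono) auto
  finally have "\<bar>?p / ?q\<bar> \<le> \<bar>x\<bar> + 1 / ?q"
    by linarith
  then have "\<bar>?p\<bar> \<le> \<bar>x\<bar> * ?q + 1"
    using q(1) by (simp add: field_simps)
  then have "\<bar>?p\<bar> \<le> (\<bar>x\<bar> + 1) * ?q"
    using q(1) by (simp add: algebra_simps)
  moreover have "?q \<le> (\<bar>x\<bar> + 1) * ?q"
    using q(1) by (simp add: algebra_simps)
  moreover have "real_of_int (rat_height (cf_convergent x k)) = max \<bar>?p\<bar> ?q"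
    using cf_denom_pos[of x k]
    by (auto simp: rat_height_def cf_denom_def max_def split: prod.splits)
  ultimately show ?thesis by simp
qed

section \<open>Strong Liouville numbers: growth of denominators, membership in the class,
  recognition of convergents\<close>

lemma strong_LiouvilleD:
  assumes "x \<in> strong_Liouville"
  shows "x \<notin> \<rat>" and "\<exists>N. \<forall>k>N. cf_denom x (Suc k) > cf_denom x k ^ n"
proof -
  show "x \<notin> \<rat>" using assms by (simp add: strong_Liouville_def)
  show "\<exists>N. \<forall>k>N. cf_denom x (Suc k) > cf_denom x k ^ n"
  proof (cases "n = 0")
    case True
    \<comment> \<open>For \<open>n = 0\<close> the claim is that the denominator exceeds 1, which
      follows from the case of exponent 1.\<close>
    obtain N where "\<forall>k>N. cf_denom x (Suc k) > cf_denom x k ^ 1"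
      using assms unfolding strong_Liouville_def by blast
    then show ?thesis
      using cf_denom_pos[of x] True by (metis power_0 power_one_right int_one_le_iff_zero_less order_le_less_trans)
  next
    case False
    then show ?thesis using assms by (simp add: strong_Liouville_def)
  qed
qed

lemma strong_Liouville_denom_growth:
  assumes "x \<in> strong_Liouville"
  obtains M where "\<And>k. k \<ge> M \<Longrightarrow> cf_denom x (Suc k) > cf_denom x k ^ n"
    and "\<And>k. k \<ge> M \<Longrightarrow> cf_denom x k \<ge> B"
    and "\<And>j k. M \<le> j \<Longrightarrow> j < k \<Longrightarrow> cf_denom x j < cf_denom x k"
proof -
  obtain N1 where N1: "\<forall>k>N1. cf_denom x (Suc k) > cf_denom x k ^ n"
    using strong_LiouvilleD(2)[OF assms] by blast
  obtain N2 where N2: "\<forall>k>N2. cf_denom x (Suc k) > cf_denom x k ^ 1"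
    using strong_LiouvilleD(2)[OF assms] by blast
  let ?d = "\<lambda>i. cf_denom x (Suc N2 + i)"
  have grow: "?d i \<ge> int i" for i
  proof (induction i)
    case 0
    then show ?case using cf_denom_pos[of x "Suc N2"] by simp
  next
    case (Suc i)
    have "?d (Suc i) > ?d i" using N2 by simp
    with Suc show ?case by linarith
  qed
  \<comment> \<open>Beyond \<open>N1\<close> the power growth holds, beyond \<open>N2\<close> the
    denominators increase strictly; being integers, they reach \<open>B\<close> after
    \<open>nat B\<close> further steps.\<close>
  define M where "M = Suc N1 + Suc N2 + nat B"
  have mono: "cf_denom x j < cf_denom x k" if "M \<le> j" "j < k" for j k
    using that(2)
  proof (induction k)
    case (Suc k)
    have "cf_denom x k < cf_denom x (Suc k)"
      using N2 that(1) Suc.prems by (simp add: M_def)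
    then show ?case
      using Suc by (metis less_Suc_eq order.strict_trans)
  qed simp
  show ?thesis
  proof
    show "cf_denom x (Suc k) > cf_denom x k ^ n" if "k \<ge> M" for k
      using N1 that by (simp add: M_def)
    show "cf_denom x k \<ge> B" if "k \<ge> M" for k
    proof -
      have "k = Suc N2 + (k - Suc N2)" "int (k - Suc N2) \<ge> B"
        using that by (auto simp: M_def)
      then show ?thesis using grow[of "k - Suc N2"] by simp
    qed
    show "cf_denom x j < cf_denom x k" if "M \<le> j" "j < k" for j k
      by (rule mono[OF that])
  qed
qed

lemma strong_Liouville_subset_Liouville_class: "strong_Liouville \<subseteq> Liouville_class"
proof
  fix x assume x: "x \<in> strong_Liouville"
  note irr = strong_LiouvilleD(1)[OF x]
  \<comment> \<open>Starting at \<open>M\<close> makes every denominator at least 2 and at least |x|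
    + 1. The latter gives \<open>h n <= q n ^ 2\<close>, so ln h and ln q agree up to a factor
    2.\<close>
  obtain M where ge: "\<And>k. k \<ge> M \<Longrightarrow> cf_denom x k \<ge> \<lceil>\<bar>x\<bar> + 1\<rceil> + 1"
    and mono: "\<And>j k. M \<le> j \<Longrightarrow> j < k \<Longrightarrow> cf_denom x j < cf_denom x k"
    using strong_Liouville_denom_growth[OF x] by metis
  define q where "q n = real_of_int (cf_denom x (M + n))" for n
  define r where "r n = cf_convergent x (M + n)" for n
  define h where "h n = real_of_int (rat_height (r n))" for n
  \<comment> \<open>Chosen so that H(r_n) to the power \<omega>_n is exactly the next
    denominator.\<close>
  define \<omega> where "\<omega> n = ln (q (Suc n)) / ln (h n)" for n
  have qx: "q n \<ge> \<bar>x\<bar> + 1" and q2: "q n \<ge> 2" for n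
    using ge[of "M + n"] unfolding q_def by linarith+
  have qh: "q n \<le> h n" for n
    using cf_denom_le_rat_height[of x "M + n"] by (simp add: q_def h_def r_def)
  have hq: "h n \<le> q n ^ 2" for n
  proof -
    have "h n \<le> (\<bar>x\<bar> + 1) * q n"
      unfolding h_def r_def q_def by (rule rat_height_cf_convergent_le[OF irr])
    also have "\<dots> \<le> q n * q n"
      using qx[of n] q2[of n] by (intro mult_right_mono) auto
    finally show ?thesis by (simp add: power2_eq_square)
  qed
  have h2: "h n \<ge> 2" for n using qh[of n] q2[of n] by linarith
  have lnq: "ln (q n) > 0" and lnh: "ln (h n) > 0" for n
    using q2[of n] h2[of n] by simp_all
  have h_powr: "h n powr (c * \<omega> n) = q (Suc n) powr c" for n c
    using lnh[of n] h2[of n] q2[of "Suc n"] by (simp add: powr_def \<omega>_def)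
  have \<omega>_pos: "\<omega> n > 0" for n
    unfolding \<omega>_def by (rule divide_pos_pos[OF lnq lnh])
  moreover have "filterlim \<omega> at_top sequentially"
  proof (rule filterlim_at_top[THEN iffD2], rule allI)
    fix Z :: real
    \<comment> \<open>The factor 2 compensates for \<open>ln (h n) <= 2 * ln (q n)\<close>.\<close>
    define m where "m = nat \<lceil>2 * Z\<rceil>"
    obtain N where N: "\<forall>k>N. cf_denom x (Suc k) > cf_denom x k ^ m"
      using strong_LiouvilleD(2)[OF x] by blast
    show "\<forall>\<^sub>F n in sequentially. Z \<le> \<omega> n"
      using eventually_gt_at_top[of N]
    proof eventually_elim
      case (elim n)
      have "cf_denom x (M + n) ^ m < cf_denom x (M + Suc n)"
        using N elim by simp
      then have "q n ^ m \<le> q (Suc n)"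
        unfolding q_def by (metis less_imp_le of_int_le_iff of_int_power)
      then have "ln (q n ^ m) \<le> ln (q (Suc n))"
        using q2[of n] q2[of "Suc n"] by (subst ln_le_cancel_iff) auto
      then have a: "real m * ln (q n) \<le> ln (q (Suc n))"
        using q2[of n] by (simp add: ln_realpow)
      have "ln (h n) \<le> ln (q n ^ 2)"
        using hq[of n] h2[of n] q2[of n] by (subst ln_le_cancel_iff) auto
      then have b: "ln (h n) \<le> 2 * ln (q n)"
        using q2[of n] by (simp add: ln_realpow)
      have "Z * ln (h n) \<le> real m / 2 * ln (h n)"
        using lnh[of n] by (intro mult_right_mono) (auto simp: m_def, linarith)
      also have "\<dots> \<le> real m / 2 * (2 * ln (q n))"
        using b by (intro mult_left_mono) auto
      also have "\<dots> \<le> ln (q (Suc n))" using a by simp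
      finally show ?case
        unfolding \<omega>_def using lnh[of n] by (simp add: pos_le_divide_eq)
    qed
  qed
  moreover have "infinite (r ` {1..})"
  proof -
    have "r i \<noteq> r j" if "i < j" for i j
      using mono[of "M + i" "M + j"] that by (auto simp: r_def cf_denom_def)
    then have "inj r" by (metis injI linorder_neqE_nat)
    then show ?thesis
      by (metis finite_imageD infinite_Ici inj_on_subset subset_UNIV)
  qed
  moreover have "\<bar>x - of_rat (r n)\<bar> < h n powr (- \<omega> n)" for n
  proof -
    have "\<bar>x - of_rat (r n)\<bar> < 1 / (q n * q (Suc n))"
      using cf_approximation[OF irr, of "M + n"] by (simp add: r_def q_def)
    also have "\<dots> \<le> 1 / q (Suc n)"
      using q2[of n] q2[of "Suc n"] by (intro divide_left_mono) auto
    also have "\<dots> = h n powr (- \<omega> n)"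
      using h_powr[of n "-1"] q2[of "Suc n"] by (simp add: powr_minus_divide)
    finally show ?thesis .
  qed
  \<comment> \<open>This is where C = 2 comes from: the next height is at most the square of the
    next denominator.\<close>
  moreover have "h (Suc n) \<le> h n powr (2 * \<omega> n)" for n
    using hq[of "Suc n"] h_powr[of n 2] q2[of "Suc n"] by simp
  ultimately show "x \<in> Liouville_class"
    unfolding Liouville_class_def h_def
    by (intro CollectI exI[of _ \<omega>] exI[of _ r] exI[of _ 2]) auto
qed

text \<open>A form of Legendre's criterion, with 4 d^2 in place of 2 d^2, that also places the index
  beyond \<open>M\<close>. It compares \<open>r\<close> with the convergent just before the
  denominators first exceed 2d.\<close>

lemma strong_Liouville_convergentI:
  assumes x: "x \<in> strong_Liouville"
    and mono: "\<And>j k. M \<le> j \<Longrightarrow> j < k \<Longrightarrow> cf_denom x j < cf_denom x k"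
    and r: "snd (quotient_of r) = d" "cf_denom x M \<le> 2 * d"
    and close: "\<bar>x - of_rat r\<bar> < 1 / (4 * of_int d ^ 2)"
  obtains k where "k \<ge> M" "r = cf_convergent x k" "cf_denom x k = d"
proof -
  have d: "d > 0" using r(1) quotient_of_denom_pos' by blast
  obtain M' where "\<And>k. k \<ge> M' \<Longrightarrow> cf_denom x k \<ge> 2 * d + 1"
    using strong_Liouville_denom_growth[OF x, of 0 "2 * d + 1"] by metis
  from this[of "M + M'"] have "cf_denom x (M + M') > 2 * d"
    by simp
  then obtain i where i: "cf_denom x (M + i) > 2 * d"
    and least: "\<And>i'. i' < i \<Longrightarrow> \<not> cf_denom x (M + i') > 2 * d"
    using exists_least_iff[of "\<lambda>i. cf_denom x (M + i) > 2 * d"] by blast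
  have "i \<noteq> 0" using i r(2) by (metis add.right_neutral not_le)
  then obtain i' where i': "i = Suc i'" by (metis nat.exhaust)
  define k where "k = M + i'"
  have up: "cf_denom x (Suc k) > 2 * d" and low: "cf_denom x k \<le> 2 * d"
    using i least[of i'] by (auto simp: i' k_def)
  have "r = cf_convergent x k"
  proof (rule ccontr)
    assume neq: "r \<noteq> cf_convergent x k"
    define q where "q = real_of_int (cf_denom x k)"
    define q' where "q' = real_of_int (cf_denom x (Suc k))"
    define e where "e = real_of_int d"
    have pos: "q > 0" "q' > 0" "e > 0" "q' > 2 * e" "q \<le> 2 * e"
      using up low d cf_denom_pos[of x k] cf_denom_pos[of x "Suc k"]
      unfolding q_def q'_def e_def by linarith+
    have "1 / (e * q) \<le> \<bar>of_rat r - of_rat (cf_convergent x k) :: real\<bar>"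
      using rat_separation[OF neq] r(1) by (simp add: e_def q_def cf_denom_def)
    also have "\<dots> \<le> \<bar>x - of_rat r\<bar> + \<bar>x - of_rat (cf_convergent x k)\<bar>"
      by linarith
    also have "\<dots> < 1 / (4 * e ^ 2) + 1 / (q * q')"
      using close cf_approximation[OF strong_LiouvilleD(1)[OF x], of k]
      by (simp add: e_def q_def q'_def)
    \<comment> \<open>Each error is at most half of the separation 1/(e q): this one because q' >
      2e, the other because q <= 2e.\<close>
    also have "1 / (q * q') \<le> 1 / (q * (2 * e))"
      using pos by (intro divide_left_mono mult_left_mono) auto
    also have "1 / (4 * e ^ 2) \<le> 1 / (2 * e * q)"
      using pos by (intro divide_left_mono) (auto simp: power2_eq_square)
    also have "1 / (2 * e * q) + 1 / (q * (2 * e)) = 1 / (e * q)"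
      using pos by (simp add: field_simps)
    finally show False by simp
  qed
  moreover have "k \<ge> M" by (simp add: k_def)
  ultimately show thesis using that r(1) by (simp add: cf_denom_def)
qed

section \<open>Lacunary sums: bounds, membership in the class, injectivity\<close>

text \<open>\<open>lacunary_number A\<close> is the sum of the series of \<open>\<epsilon>\<^sub>m / 2 ^ (m + 2)!\<close> over \<open>m \<ge> 0\<close>, where
  \<open>\<epsilon>\<^sub>m\<close> is 3 or 1 according to whether \<open>m \<in> A\<close>. The digits are odd so that the partial sums are
  in lowest terms.\<close>

definition lacunary_denom :: "nat \<Rightarrow> int" where
  "lacunary_denom n = 2 ^ fact (n + 2)"

primrec lacunary_num :: "nat set \<Rightarrow> nat \<Rightarrow> int" where
  "lacunary_num A 0 = (if 0 \<in> A then 3 else 1)"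
| "lacunary_num A (Suc n) =
     lacunary_num A n * lacunary_denom n ^ (n + 2) + (if Suc n \<in> A then 3 else 1)"

definition lacunary_sum :: "nat set \<Rightarrow> nat \<Rightarrow> rat" where
  "lacunary_sum A n = Fract (lacunary_num A n) (lacunary_denom n)"

definition lacunary_number :: "nat set \<Rightarrow> real" where
  "lacunary_number A = (SUP n. of_rat (lacunary_sum A n))"

lemma lacunary_denom_Suc: "lacunary_denom (Suc n) = lacunary_denom n ^ (n + 3)"
proof -
  have "(fact (Suc n + 2) :: nat) = fact (n + 2) * (n + 3)"
    by (simp add: algebra_simps)
  then show ?thesis by (simp only: lacunary_denom_def power_mult)
qed

lemma lacunary_denom_ge: "lacunary_denom n \<ge> 4" "lacunary_denom n > int n"
proof -
  have "(2::nat) \<le> fact (n + 2)"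
    using le_trans[OF le_add2 fact_ge_self] .
  then have "(2::int) ^ 2 \<le> lacunary_denom n"
    unfolding lacunary_denom_def by (intro power_increasing) auto
  then show "lacunary_denom n \<ge> 4" by simp
  have "int n \<le> int (fact (n + 2))" using fact_ge_self[of "n + 2"] by linarith
  also have "\<dots> < lacunary_denom n"
    unfolding lacunary_denom_def by (rule of_nat_less_two_power)
  finally show "lacunary_denom n > int n" .
qed

lemma lacunary_num_odd: "odd (lacunary_num A n)"
proof -
  have "even (lacunary_denom n)" for n by (simp add: lacunary_denom_def)
  then show ?thesis by (cases n) auto
qed

lemma quotient_of_lacunary_sum:
  "quotient_of (lacunary_sum A n) = (lacunary_num A n, lacunary_denom n)"
proof -
  have "coprime (lacunary_num A n) (lacunary_denom n)"
    unfolding lacunary_denom_def using lacunary_num_odd[of A n]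
    by (simp only: coprime_power_right_iff coprime_right_2_iff_odd simp_thms)
  then show ?thesis
    using lacunary_denom_ge(1)[of n]
    by (simp add: lacunary_sum_def quotient_of_Fract normalize_stable)
qed

lemma of_rat_lacunary_sum:
  "(of_rat (lacunary_sum A n) :: real) = of_int (lacunary_num A n) / of_int (lacunary_denom n)"
  by (simp add: of_rat_eq_quotient quotient_of_lacunary_sum)

text \<open>The factor \<open>lacunary_denom n ^ (n + 2)\<close> in the numerator recursion is the
  ratio of consecutive denominators.\<close>

lemma lacunary_sum_Suc:
  "(of_rat (lacunary_sum A (Suc n)) :: real)
    = of_rat (lacunary_sum A n) + (if Suc n \<in> A then 3 else 1) / of_int (lacunary_denom (Suc n))"
proof -
  have "real_of_int (lacunary_denom n) \<noteq> 0" using lacunary_denom_ge(1)[of n] by simp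
  then show ?thesis
    by (simp add: of_rat_lacunary_sum lacunary_denom_Suc field_simps power_add numeral_3_eq_3)
qed

lemma lacunary_denom_Suc_ge: "lacunary_denom (Suc n) \<ge> 4 * lacunary_denom n"
proof -
  have "4 * lacunary_denom n \<le> lacunary_denom n * lacunary_denom n"
    using lacunary_denom_ge(1)[of n] by (intro mult_right_mono) auto
  also have "\<dots> \<le> lacunary_denom n ^ (n + 3)"
    using lacunary_denom_ge(1)[of n] power_increasing[of 2 "n + 3" "lacunary_denom n"]
    by (simp add: power2_eq_square)
  finally show ?thesis by (simp add: lacunary_denom_Suc)
qed

lemma incseq_lacunary_sum: "incseq (\<lambda>n. of_rat (lacunary_sum A n) :: real)"
proof (rule incseq_SucI)
  fix n
  show "(of_rat (lacunary_sum A n) :: real) \<le> of_rat (lacunary_sum A (Suc n))"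
    using lacunary_denom_ge(1)[of "Suc n"] unfolding lacunary_sum_Suc by simp
qed

text \<open>With d and e the next two denominators, a digit is at most 3 and e >= 4d, so 3/d + 4/e
  <= 4/d. These decreasing upper bounds control the tail without summing it.\<close>

lemma decseq_lacunary_sum_tail:
  "decseq (\<lambda>n. of_rat (lacunary_sum A n) + 4 / real_of_int (lacunary_denom (Suc n)))"
proof (rule decseq_SucI)
  fix n
  let ?d = "real_of_int (lacunary_denom (Suc n))" and ?e = "real_of_int (lacunary_denom (Suc (Suc n)))"
  have "?d > 0" "?e \<ge> 4 * ?d"
    using lacunary_denom_Suc_ge[of "Suc n"] lacunary_denom_ge(1)[of "Suc n"] by linarith+
  then have "4 / ?e \<le> 4 / (4 * ?d)"
    by (intro divide_left_mono) auto
  then have "4 / ?e \<le> 1 / ?d" by simp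
  moreover have "(if Suc n \<in> A then 3 else 1) / ?d \<le> 3 / ?d"
    using \<open>?d > 0\<close> by (intro divide_right_mono) auto
  ultimately show "of_rat (lacunary_sum A (Suc n)) + 4 / ?e \<le> of_rat (lacunary_sum A n) + 4 / ?d"
    unfolding lacunary_sum_Suc by (simp only: add_divide_distrib[of 3 1 ?d, simplified])
qed

lemma lacunary_sum_le_tail:
  "(of_rat (lacunary_sum A m) :: real)
    \<le> of_rat (lacunary_sum A n) + 4 / of_int (lacunary_denom (Suc n))"
proof -
  have le: "(of_rat (lacunary_sum A i) :: real)
      \<le> of_rat (lacunary_sum A i) + 4 / of_int (lacunary_denom (Suc i))" for i
    using lacunary_denom_ge(1)[of "Suc i"] by simp
  show ?thesis
  proof (cases "m \<le> n")
    case True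
    show ?thesis
      using incseqD[OF incseq_lacunary_sum True, of A] le[of n] by linarith
  next
    case False
    then show ?thesis
      using decseqD[OF decseq_lacunary_sum_tail, of n m A] le[of m] by linarith
  qed
qed

lemma lacunary_number_bounds:
  shows lacunary_sum_le_number: "of_rat (lacunary_sum A n) \<le> lacunary_number A"
    and lacunary_number_le:
      "lacunary_number A \<le> of_rat (lacunary_sum A n) + 4 / of_int (lacunary_denom (Suc n))"
proof -
  have "bdd_above (range (\<lambda>n. of_rat (lacunary_sum A n) :: real))"
    using lacunary_sum_le_tail[of A _ 0] by (intro bdd_aboveI2)
  then show "of_rat (lacunary_sum A n) \<le> lacunary_number A"
    unfolding lacunary_number_def by (intro cSUP_upper) auto
  show "lacunary_number A \<le> of_rat (lacunary_sum A n) + 4 / of_int (lacunary_denom (Suc n))"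
    unfolding lacunary_number_def by (intro cSUP_least lacunary_sum_le_tail) auto
qed

text \<open>The first omitted term alone is this large. The bound later limits the denominator of
  the convergent following a partial sum.\<close>

lemma lacunary_number_gap:
  "lacunary_number A - of_rat (lacunary_sum A n) \<ge> 1 / of_int (lacunary_denom (Suc n))"
proof -
  have "1 / real_of_int (lacunary_denom (Suc n))
      \<le> (if Suc n \<in> A then 3 else 1) / of_int (lacunary_denom (Suc n))"
    using lacunary_denom_ge(1)[of "Suc n"] by (intro divide_right_mono) auto
  then show ?thesis
    using lacunary_sum_le_number[of A "Suc n"] unfolding lacunary_sum_Suc by linarith
qed

lemma rat_height_lacunary_sum: "rat_height (lacunary_sum A n) = lacunary_denom n"
proof -
  have d: "real_of_int (lacunary_denom n) > 0" using lacunary_denom_ge(1)[of n] by simp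
  have "(of_rat (lacunary_sum A n) :: real) \<le> of_rat (lacunary_sum A 0) + 4 / of_int (lacunary_denom (Suc 0))"
    by (rule lacunary_sum_le_tail)
  \<comment> \<open>In the worst case this is 3/4 + 4/64.\<close>
  also have "\<dots> \<le> 1"
    by (simp add: of_rat_lacunary_sum lacunary_denom_def fact_numeral)
  finally have "lacunary_num A n \<le> lacunary_denom n"
    using d by (simp add: of_rat_lacunary_sum)
  moreover have "lacunary_num A n \<ge> 0"
    using lacunary_denom_ge(1) by (induction n) (auto intro!: add_nonneg_nonneg mult_nonneg_nonneg zero_le_power order_trans[OF _ lacunary_denom_ge(1)])
  ultimately show ?thesis
    by (simp add: rat_height_def quotient_of_lacunary_sum)
qed

text \<open>The exponent n + 1 leaves two spare powers of Q_n in Q_{n+1} = Q_n^(n+3), enough to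
  absorb the 4 of the tail bound. The constant 3 works because n + 3 <= 3(n + 1).\<close>

lemma lacunary_number_in_Liouville_class: "lacunary_number A \<in> Liouville_class"
proof -
  define d where "d n = real_of_int (lacunary_denom n)" for n
  have d4: "d n \<ge> 4" for n using lacunary_denom_ge(1)[of n] by (simp add: d_def)
  have dSuc: "d (Suc n) = d n ^ (n + 3)" for n by (simp add: d_def lacunary_denom_Suc)
  have powr: "d n powr real m = d n ^ m" for n m
    using d4[of n] by (intro powr_realpow) linarith
  have "\<bar>lacunary_number A - of_rat (lacunary_sum A n)\<bar> < d n powr (- real (Suc n))" for n
  proof -
    have "\<bar>lacunary_number A - of_rat (lacunary_sum A n)\<bar> \<le> 4 / d (Suc n)"
      using lacunary_number_bounds[of A n] by (simp add: d_def)
    also have "\<dots> < 1 / d n ^ Suc n"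
    proof -
      have "4 * d n ^ Suc n < d n ^ 2 * d n ^ Suc n"
        using d4[of n] power_mono[of 4 "d n" 2] by (intro mult_strict_right_mono) auto
      also have "\<dots> = d (Suc n)" unfolding dSuc by (simp add: power_add power2_eq_square power3_eq_cube)
      finally show ?thesis
        using d4[of n] d4[of "Suc n"] by (simp add: field_simps)
    qed
    also have "\<dots> = d n powr (- real (Suc n))"
      by (simp only: powr_minus_divide powr)
    finally show ?thesis .
  qed
  moreover have "d (Suc n) \<le> d n powr (3 * real (Suc n))" for n
  proof -
    have "d (Suc n) \<le> d n ^ (3 * Suc n)"
      unfolding dSuc using d4[of n] by (intro power_increasing) auto
    also have "\<dots> = d n powr (3 * real (Suc n))"
      by (metis powr of_nat_mult of_nat_numeral)
    finally show ?thesis .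
  qed
  moreover have "infinite (lacunary_sum A ` {1..})"
  proof -
    have "strict_mono lacunary_denom"
      unfolding strict_mono_Suc_iff
    proof
      show "lacunary_denom n < lacunary_denom (Suc n)" for n
        using lacunary_denom_Suc_ge[of n] lacunary_denom_ge(1)[of n] by linarith
    qed
    then have "inj (lacunary_sum A)"
      by (metis injI quotient_of_lacunary_sum prod.inject strict_mono_eq)
    then show ?thesis
      by (metis finite_imageD infinite_Ici inj_on_subset subset_UNIV)
  qed
  moreover have "filterlim (\<lambda>n. real (Suc n)) at_top sequentially"
    by (rule filterlim_compose[OF filterlim_real_sequentially filterlim_Suc])
  ultimately show ?thesis
    unfolding Liouville_class_def d_def
    by (intro CollectI exI[of _ "\<lambda>n. real (Suc n)"] exI[of _ "lacunary_sum A"] exI[of _ 3])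
      (auto simp: rat_height_lacunary_sum)
qed

text \<open>The order is lexicographic: at the first differing digit the sums differ by 2/Q_n, while
  the tail is at most 4/Q_{n+1} <= 1/Q_n.\<close>

lemma inj_lacunary_number: "inj lacunary_number"
proof -
  have less: "lacunary_number A < lacunary_number B"
    if first: "\<And>i. i < n \<Longrightarrow> i \<in> A \<longleftrightarrow> i \<in> B" and n: "n \<notin> A" "n \<in> B" for A B n
  proof -
    let ?d = "real_of_int (lacunary_denom n)"
    have num: "lacunary_num A n + 2 = lacunary_num B n"
    proof -
      have "lacunary_num A i = lacunary_num B i" if "i < n" for i
        using that first by (induction i) auto
      then show ?thesis using n by (cases n) auto
    qed
    have d: "?d \<ge> 4" "real_of_int (lacunary_denom (Suc n)) \<ge> 4 * ?d"
      using lacunary_denom_ge(1)[of n] lacunary_denom_Suc_ge[of n] by linarith+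
    then have "4 / real_of_int (lacunary_denom (Suc n)) \<le> 4 / (4 * ?d)"
      by (intro divide_left_mono) auto
    also have "\<dots> < 2 / ?d" using d by (simp add: field_simps)
    finally have "lacunary_number A < of_rat (lacunary_sum A n) + 2 / ?d"
      using lacunary_number_le[of A n] by linarith
    also have "\<dots> = of_rat (lacunary_sum B n)"
      by (simp add: of_rat_lacunary_sum flip: num add_divide_distrib)
    also have "\<dots> \<le> lacunary_number B" by (rule lacunary_sum_le_number)
    finally show ?thesis .
  qed
  show ?thesis
  proof (rule injI, rule ccontr)
    fix A B assume eq: "lacunary_number A = lacunary_number B" and "A \<noteq> B"
    then have "\<exists>n. (n \<in> A) \<noteq> (n \<in> B)" by blast
    then obtain n where "(n \<in> A) \<noteq> (n \<in> B)" "\<And>i. i < n \<Longrightarrow> (i \<in> A) = (i \<in> B)"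
      by (metis exists_least_iff[of "\<lambda>n. (n \<in> A) \<noteq> (n \<in> B)"])
    then show False using less[of n A B] less[of n B A] eq by auto
  qed
qed

section \<open>Lacunary numbers are not strong Liouville numbers\<close>

lemma lacunary_number_not_strong_Liouville: "lacunary_number A \<notin> strong_Liouville"
proof
  let ?x = "lacunary_number A"
  assume x: "?x \<in> strong_Liouville"
  note irr = strong_LiouvilleD(1)[OF x]
  obtain M where growth: "\<And>k. k \<ge> M \<Longrightarrow> cf_denom ?x (Suc k) > cf_denom ?x k ^ 2"
    and mono: "\<And>j k. M \<le> j \<Longrightarrow> j < k \<Longrightarrow> cf_denom ?x j < cf_denom ?x k"
    using strong_Liouville_denom_growth[OF x, of 2] by metis
  \<comment> \<open>The 3 ensures n + 3 <= 2n for the final comparison; the other entry puts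
    \<open>cf_denom ?x M\<close> below Q_n, as recognising convergents beyond \<open>M\<close>
    requires.\<close>
  define n where "n = max 3 (nat (cf_denom ?x M))"
  have convergent: "\<exists>k\<ge>M. lacunary_sum A i = cf_convergent ?x k \<and> cf_denom ?x k = lacunary_denom i"
    if i: "i \<ge> n" for i
  proof -
    let ?d = "real_of_int (lacunary_denom i)"
    have d: "?d \<ge> 4" using lacunary_denom_ge(1)[of i] by simp
    have "i \<ge> 3" "cf_denom ?x M \<le> 2 * lacunary_denom i"
      using i lacunary_denom_ge[of i] by (auto simp: n_def)
    \<comment> \<open>The aim is 16 d^2 < d^5 <= Q_{i+1}, so that the tail bound 4/Q_{i+1} drops
      below 1/(4 d^2).\<close>
    have "(4::real) ^ 3 \<le> ?d ^ 3" by (rule power_mono[OF d]) simp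
    then have "16 < ?d ^ 3" by simp
    moreover have "0 < ?d ^ 2" using d by (intro zero_less_power) linarith
    ultimately have "16 * ?d ^ 2 < ?d ^ 3 * ?d ^ 2"
      by (rule mult_strict_right_mono)
    also have "\<dots> = ?d ^ 5" by (simp flip: power_add)
    also have "\<dots> \<le> ?d ^ (i + 3)"
      using d \<open>i \<ge> 3\<close> by (intro power_increasing) linarith+
    also have "\<dots> = of_int (lacunary_denom (Suc i))" by (simp add: lacunary_denom_Suc)
    finally have "4 / real_of_int (lacunary_denom (Suc i)) < 1 / (4 * ?d ^ 2)"
      using d lacunary_denom_ge(1)[of "Suc i"] by (simp add: field_simps)
    then have "\<bar>?x - of_rat (lacunary_sum A i)\<bar> < 1 / (4 * ?d ^ 2)"
      using lacunary_number_bounds[of A i] by linarith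
    moreover have "snd (quotient_of (lacunary_sum A i)) = lacunary_denom i"
      by (simp add: quotient_of_lacunary_sum)
    ultimately obtain k where "k \<ge> M" "lacunary_sum A i = cf_convergent ?x k"
        "cf_denom ?x k = lacunary_denom i"
      using strong_Liouville_convergentI[OF x mono _ \<open>cf_denom ?x M \<le> _\<close>] by blast
    then show ?thesis by blast
  qed
  define D where "D = lacunary_denom n"
  have D4: "D \<ge> 4" by (simp add: D_def lacunary_denom_ge)
  have D': "lacunary_denom (Suc n) = D ^ (n + 3)" by (simp add: D_def lacunary_denom_Suc)
  obtain k where k: "k \<ge> M" "lacunary_sum A n = cf_convergent ?x k" "cf_denom ?x k = D"
    using convergent[of n] by (auto simp: D_def)
  obtain j where j: "j \<ge> M" "cf_denom ?x j = D ^ (n + 3)"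
    using convergent[of "Suc n"] by (auto simp: D')
  define q where "q = cf_denom ?x (Suc k)"
  define q' where "q' = cf_denom ?x (Suc (Suc k))"
  have q: "q > D ^ 2" and q': "q' > q ^ 2"
    using growth[of k] growth[of "Suc k"] k by (simp_all add: q_def q'_def)
  have "D ^ 2 \<ge> 4 * D" using D4 by (simp add: power2_eq_square)
  with q D4 have q16: "q \<ge> 16" by linarith
  have approx: "\<bar>?x - of_rat (cf_convergent ?x k)\<bar> < 1 / (of_int D * of_int q)"
    using cf_approximation[OF irr, of k] k by (simp add: q_def)
  \<comment> \<open>The gap below \<open>?x\<close> and the error of the convergent together bound D
    q by Q_{n+1}; hence index \<open>j\<close> comes after \<open>Suc k\<close>.\<close>
  have "1 / real_of_int (D ^ (n + 3)) < 1 / real_of_int (D * q)"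
    using approx lacunary_number_gap[of n A] k(2) by (simp add: D')
  then have "real_of_int (D * q) < real_of_int (D ^ (n + 3))"
    using D4 q16 by (simp add: divide_less_cancel field_simps)
  then have "D * q < D ^ (n + 3)" by (simp only: of_int_less_iff)
  moreover have "1 * q \<le> D * q" using D4 q16 by (intro mult_right_mono) auto
  ultimately have "cf_denom ?x (Suc k) < cf_denom ?x j"
    by (simp add: j q_def)
  then have "Suc k < j"
    using mono[of j "Suc k"] j(1) by (metis linorder_neqE_nat order_less_asym order_less_irrefl)
  then have "q' \<le> D ^ (n + 3)"
    using mono[of "Suc (Suc k)" j] k(1) j by (cases "Suc (Suc k) = j") (auto simp: q'_def)
  moreover have "q' > D ^ (n + 3)"
  proof -
    have "q \<le> q ^ 2" using q16 by (simp add: power2_eq_square)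
    \<comment> \<open>With q' >= 2D the error of the next convergent uses up at most half of the
      separation 1/(D q). The other half must be covered by 4/Q_{n+1}, giving Q_{n+1} <= 8 D
      q.\<close>
    then have q'2: "q' \<ge> 2 * D" using q q' \<open>D ^ 2 \<ge> 4 * D\<close> D4 by linarith
    have "cf_convergent ?x k \<noteq> cf_convergent ?x (Suc k)"
      using mono[OF k(1), of "Suc k"] by (auto simp: cf_denom_def)
    then have "1 / (real_of_int D * of_int q)
        \<le> \<bar>of_rat (cf_convergent ?x k) - of_rat (cf_convergent ?x (Suc k))\<bar>"
      using rat_separation k(3) by (metis cf_denom_def q_def)
    also have "\<dots> \<le> \<bar>?x - of_rat (cf_convergent ?x k)\<bar> + \<bar>?x - of_rat (cf_convergent ?x (Suc k))\<bar>"
      by linarith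
    also have "\<bar>?x - of_rat (cf_convergent ?x k)\<bar> \<le> 4 / of_int (D ^ (n + 3))"
      using lacunary_number_bounds[of A n] k(2) by (simp add: D')
    also have "\<bar>?x - of_rat (cf_convergent ?x (Suc k))\<bar> \<le> 1 / (of_int q * of_int q')"
      using cf_approximation[OF irr, of "Suc k"] by (simp add: q_def q'_def)
    also have "1 / (real_of_int q * of_int q') \<le> 1 / (real_of_int q * of_int (2 * D))"
      using q16 D4 q'2 by (intro divide_left_mono mult_left_mono mult_pos_pos) auto
    finally have "1 / (real_of_int D * of_int q)
        \<le> 4 / of_int (D ^ (n + 3)) + 1 / (real_of_int q * of_int (2 * D))"
      by simp
    moreover have "1 / (real_of_int D * of_int q) - 1 / (real_of_int q * of_int (2 * D))
        = 1 / (2 * of_int D * of_int q)"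
      using q16 D4 by (simp add: field_simps)
    ultimately have "1 / (2 * real_of_int D * of_int q) \<le> 4 / of_int (D ^ (n + 3))"
      by linarith
    then have "real_of_int (D ^ (n + 3)) \<le> real_of_int (8 * D * q)"
      using q16 D4 by (simp add: field_simps)
    then have "D ^ (n + 3) \<le> 8 * D * q" by (simp only: of_int_le_iff)
    \<comment> \<open>Absorbing 8 into D^2 leaves q >= D^n, and then q' > q^2 >= D^(2n) >=
      D^(n+3).\<close>
    also have "8 * D * q \<le> D ^ 2 * D * q"
      using D4 q16 power_mono[of 4 D 2] by (intro mult_right_mono) auto
    finally have "D ^ 3 * D ^ n \<le> D ^ 3 * q"
      by (simp add: power_add power2_eq_square power3_eq_cube mult_ac)
    then have "D ^ n \<le> q" using D4 by simp
    then have "(D ^ n) ^ 2 \<le> q ^ 2" using D4 by (intro power_mono) auto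
    moreover have "D ^ (n + 3) \<le> (D ^ n) ^ 2"
      unfolding power_mult[symmetric] using D4 by (intro power_increasing) (auto simp: n_def)
    ultimately show ?thesis using q' by linarith
  qed
  ultimately show False by simp
qed

theorem mainTheorem2:
  "strong_Liouville \<subseteq> Liouville_class \<and> uncountable (Liouville_class - strong_Liouville)"
proof
  show "strong_Liouville \<subseteq> Liouville_class" by (rule strong_Liouville_subset_Liouville_class)
  \<comment> \<open>Otherwise \<open>from_nat_into\<close> would enumerate all sets of naturals,
    against Cantor's theorem.\<close>
  have "uncountable (UNIV :: nat set set)"
    using Cantors_theorem[of "UNIV :: nat set"] range_from_nat_into[of "UNIV :: nat set set"]
    by (metis Pow_UNIV UNIV_not_empty)
  then have "uncountable (range lacunary_number)"
    using inj_lacunary_number countable_image_inj_on by blast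
  moreover have "range lacunary_number \<subseteq> Liouville_class - strong_Liouville"
    using lacunary_number_in_Liouville_class lacunary_number_not_strong_Liouville by blast
  ultimately show "uncountable (Liouville_class - strong_Liouville)"
    using countable_subset by blast
qed

end
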